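(* For any $\ell > 0$, the word $\mathbf{vtm}$ avoids $(1, \mathrm{rev}_{\ell})$-squares. That is, $\mathbf{vtm}$ contains neither reflection squares nor squares as factors.
   Context: The word $\mathbf{vtm} \in \{0,1,2\}^{\omega}$ is the infinite fixed point of the morphism $0 \mapsto 012$, $1 \mapsto 02$, $2 \mapsto 1$ (it begins with $0$). A factor of an infinite word is a finite contiguous subsequence. For $\ell>0$, $\mathrm{rev}_\ell \cong \mathbb{Z}/2\mathbb{Z}$ is the group whose generator acts on words of length $\ell$ by reversing the order of the symbols. A $(1,\mathrm{rev}_\ell)$-square is a word $xy$ with $|x| = |y| = \ell$ such that $y = h\cdot x$ for some $h \in \mathrm{rev}_\ell$. A square is a word $xx$ with $|x|>0$; a reflection square is a word $xy$ with $|x|=|y|=\ell>0$ and $x = g\cdot y$, where $g$ is the generator of $\mathrm{rev}_\ell$ (i.e., $x$ is the reversal of $y$). Avoiding a class of words means having no factor in that class. *)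

theory Defs
  imports
    "HOL-Library.Omega_Words_Fun"
    "HOL-Algebra.Elementary_Groups"
    "HOL-Algebra.Group_Action"
begin

definition factor :: "'a list \<Rightarrow> 'a word \<Rightarrow> bool" where
  "factor u w \<longleftrightarrow> (\<exists>i j. u = subsequence w i j)"

definition avoids :: "'a word \<Rightarrow> 'a list set \<Rightarrow> bool" where
  "avoids w C \<longleftrightarrow> \<not> (\<exists>u\<in>C. factor u w)"


text \<open>A morphism is given by its values on letters and acts on a finite word \<open>u\<close> as
  \<open>concat (map f u)\<close>. If it is nonerasing, then the image of the first \<open>n + 1\<close> letters of an
  infinite word \<open>w\<close> has length at least \<open>n + 1\<close>, so it determines the \<open>n\<close>-th letter of the
  infinite word \<open>f (w 0) f (w 1) f (w 2) ...\<close>. The definition is only meant for nonerasing \<open>f\<close>;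
  see \<open>prefix_morph_word\<close> below.\<close>

definition morph_word :: "('a \<Rightarrow> 'b list) \<Rightarrow> 'a word \<Rightarrow> 'b word" where
  "morph_word f w = (\<lambda>n. concat (map f (prefix (Suc n) w)) ! n)"

datatype letter = L0 | L1 | L2

fun vtm_morph :: "letter \<Rightarrow> letter list" where
  "vtm_morph L0 = [L0, L1, L2]"
| "vtm_morph L1 = [L0, L2]"
| "vtm_morph L2 = [L1]"

text \<open>Existence and uniqueness of the fixed point are proved in \<open>vtm_ex1\<close> below.\<close>

definition vtm :: "letter word" where
  "vtm = (THE w. morph_word vtm_morph w = w)"


text \<open>The group of reversals is \<open>\<int>/2\<int>\<close>, with elements \<open>0\<close> and \<open>1\<close>; here \<open>1\<close> is the
  generator and \<open>0\<close> the neutral element. It is kept separate from its action because the action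
  on words of length 1 is not faithful.\<close>

definition rev_group :: "int monoid" where
  "rev_group = integer_mod_group 2"

definition rev_action :: "nat \<Rightarrow> int \<Rightarrow> 'a list \<Rightarrow> 'a list" where
  "rev_action l h = (\<lambda>x\<in>{x. length x = l}. if h = 1 then rev x else x)"

definition rev_squares :: "nat \<Rightarrow> 'a list set" where
  "rev_squares l = {x @ y |x y. length x = l \<and> length y = l \<and>
     (\<exists>h\<in>carrier rev_group. y = rev_action l h x)}"

definition squares :: "'a list set" where
  "squares = {x @ x |x. length x > 0}"

definition reflection_squares :: "'a list set" where
  "reflection_squares = {x @ y |x y l. l > 0 \<and> length x = l \<and> length y = l \<and> x = rev_action l 1 y}"


lemma rev_action_group_action:
  "group_action rev_group {x :: 'a list. length x = l} (rev_action l)"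
proof -
  let ?E = "{x :: 'a list. length x = l}"
  have bij: "rev_action l h \<in> Bij ?E" for h
  proof -
    have "bij_betw (\<lambda>x. if h = 1 then rev x else x) ?E ?E"
      by (rule bij_betw_byWitness[where f' = "\<lambda>x. if h = 1 then rev x else x"]) auto
    then show ?thesis
      by (simp add: Bij_def rev_action_def bij_betw_restrict_eq)
  qed
  have "carrier rev_group = {0, 1}"
    by (auto simp: rev_group_def carrier_integer_mod_group)
  moreover have "mult rev_group g h = (g + h) mod 2" for g h
    by (simp add: rev_group_def)
  moreover have "mult (BijGroup ?E) (rev_action l g) (rev_action l h)
      = compose ?E (rev_action l g) (rev_action l h)" for g h
    using bij by (simp add: BijGroup_def)
  moreover have "compose ?E (rev_action l g) (rev_action l h) = rev_action l ((g + h) mod 2)"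
    if "g \<in> {0, 1}" "h \<in> {0, 1}" for g h
    using that by (auto simp: compose_def rev_action_def fun_eq_iff restrict_def)
  ultimately have "rev_action l \<in> hom rev_group (BijGroup ?E)"
    using bij by (simp add: hom_def) (simp add: BijGroup_def)
  moreover have "group rev_group"
    by (simp add: rev_group_def)
  ultimately show ?thesis
    by (auto simp: group_action_def group_hom_def group_hom_axioms_def group_BijGroup)
qed

lemma length_concat_map_ge:
  assumes "\<And>a. f a \<noteq> []"
  shows "length u \<le> length (concat (map f u))"
proof (induction u)
  case (Cons a u)
  have "length (f a) \<ge> 1" using assms[of a] by (cases "f a") auto
  then show ?case using Cons by simp
qed simp

lemma concat_map_prefix_nth:
  assumes "m \<le> n" "k < length (concat (map f (prefix m w)))"
  shows "concat (map f (prefix n w)) ! k = concat (map f (prefix m w)) ! k"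
proof -
  have "prefix n w = prefix m w @ subsequence w m n"
    using subsequence_append[of w m "n - m"] assms(1) by simp
  then show ?thesis using assms(2) by (simp add: nth_append)
qed

lemma prefix_morph_word:
  assumes "\<And>a. f a \<noteq> []"
  shows "prefix (length (concat (map f (prefix n w)))) (morph_word f w) = concat (map f (prefix n w))"
proof (rule nth_equalityI)
  fix k
  assume "k < length (prefix (length (concat (map f (prefix n w)))) (morph_word f w))"
  then have k: "k < length (concat (map f (prefix n w)))" by simp
  have k': "k < length (concat (map f (prefix (Suc k) w)))"
    using length_concat_map_ge[of f "prefix (Suc k) w"] assms by simp
  have "concat (map f (prefix (Suc k) w)) ! k = concat (map f (prefix n w)) ! k"
    using concat_map_prefix_nth[OF _ k, of "Suc k"] concat_map_prefix_nth[OF _ k', of n]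
    by (cases "n \<le> Suc k") auto
  then show "prefix (length (concat (map f (prefix n w)))) (morph_word f w) ! k
      = concat (map f (prefix n w)) ! k"
    using k by (simp add: morph_word_def)
qed simp

lemma vtm_morph_nonempty: "vtm_morph a \<noteq> []"
  by (cases a) auto

lemma morph_word_vtm_morph:
  assumes "w 0 = L0" "n > 0"
  shows "morph_word vtm_morph w n = concat (map vtm_morph (prefix n w)) ! n"
proof -
  obtain m where n: "n = Suc m" using assms(2) by (cases n) auto
  have "prefix n w = w 0 # subsequence w 1 n"
    using upt_conv_Cons[of 0 n] assms(2) by (simp add: subsequence_def)
  moreover have "length (concat (map vtm_morph (subsequence w 1 n))) \<ge> m"
    using length_concat_map_ge[of vtm_morph "subsequence w 1 n"] vtm_morph_nonempty n by simp
  ultimately have "n < length (concat (map vtm_morph (prefix n w)))"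
    using assms(1) n by simp
  then show ?thesis
    using concat_map_prefix_nth[of n "Suc n" n vtm_morph w] by (simp add: morph_word_def)
qed

function vtm_rec :: "nat \<Rightarrow> letter" where
  "vtm_rec n = (if n = 0 then L0 else concat (map vtm_morph (map vtm_rec [0..<n])) ! n)"
  by auto
termination by (relation "measure id") auto

declare vtm_rec.simps [simp del]

lemma vtm_ex1: "\<exists>!w. morph_word vtm_morph w = w"
proof (rule ex1I)
  show "morph_word vtm_morph vtm_rec = vtm_rec"
  proof
    fix n
    have "vtm_rec 0 = L0" by (simp add: vtm_rec.simps[of 0])
    then show "morph_word vtm_morph vtm_rec n = vtm_rec n"
      using morph_word_vtm_morph[of vtm_rec n]
      by (cases "n = 0") (simp_all add: morph_word_def subsequence_def vtm_rec.simps[of n])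
  qed
next
  fix w
  assume fp: "morph_word vtm_morph w = w"
  have "w 0 = vtm_morph (w 0) ! 0"
    using fun_cong[OF fp, of 0] vtm_morph_nonempty[of "w 0"]
    by (simp add: morph_word_def subsequence_def)
  then have w0: "w 0 = L0" by (cases "w 0") auto
  have "w n = vtm_rec n" for n
  proof (induction n rule: less_induct)
    case (less n)
    show ?case
    proof (cases "n = 0")
      case False
      have eq: "map w [0..<n] = map vtm_rec [0..<n]" using less by auto
      have "w n = concat (map vtm_morph (map w [0..<n])) ! n"
        using morph_word_vtm_morph[of w n] w0 False fun_cong[OF fp, of n]
        by (simp add: subsequence_def)
      also have "\<dots> = vtm_rec n"
        using False by (simp only: eq vtm_rec.simps[of n] if_False)
      finally show ?thesis .
    qed (simp add: w0 vtm_rec.simps[of 0])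
  qed
  then show "w = vtm_rec" by auto
qed

lemma vtm_fixed_point: "morph_word vtm_morph vtm = vtm"
  unfolding vtm_def by (rule theI'[OF vtm_ex1])

end

theory Submission
  imports Defs
begin

text \<open>
  The word \<open>vtm\<close> records the increments of the Thue-Morse sequence \<open>t\<close>: its letters \<open>0\<close>, \<open>1\<close>, \<open>2\<close>
  stand for \<open>t (n + 1) - t n = 1, 0, -1\<close> respectively (\<open>vtm_eq_tm_increments\<close>). A letter with
  increment \<open>d\<close> has an image of length \<open>2 + d\<close>, so the images of the first \<open>n\<close> letters have total
  length \<open>2 * n + t n\<close>; this telescoping is what makes the word of increments a fixed point.

  A square of period \<open>l\<close> in \<open>vtm\<close> consists of two blocks with equal total increments, and the two
  increments are consecutive differences of three numbers in \<open>{0, 1}\<close>. Such equal differences are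
  \<open>0\<close>, so \<open>t\<close> itself agrees with its shift by \<open>l\<close> on \<open>l + 1\<close> consecutive positions: it contains an
  overlap. But \<open>t\<close> is overlap-free (\<open>tm_overlap_free\<close>). An overlap of even period gives one of half
  the period by passing to the positions of one parity. An overlap of odd period would be
  alternating, since every \<open>t (2 * j)\<close> differs from \<open>t (2 * j + 1)\<close> and the shift exchanges the
  parities, and an alternating word does not repeat at an odd distance.

  Finally, a reflection square is an even palindrome, with two equal letters at its centre, so it
  contains a square of period 1.
\<close>

section \<open>Overlap-freeness of the Thue-Morse sequence\<close>

function tm :: "nat \<Rightarrow> bool" where
  "tm n = (if n = 0 then False else tm (n div 2) \<noteq> odd n)"
  by auto
termination by (relation "measure id") auto

declare tm.simps [simp del]

lemma tm_0: "\<not> tm 0"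
  by (simp add: tm.simps)

lemma tm_double: "tm (2 * n) = tm n"
  using tm.simps[of "2 * n"] tm_0 by (cases "n = 0") auto

lemma tm_double_Suc: "tm (Suc (2 * n)) = (\<not> tm n)"
  by (subst tm.simps) simp

lemma tm_Suc_even:
  assumes "even n"
  shows "tm (Suc n) \<noteq> tm n"
  using assms by (auto elim!: evenE simp: tm_double tm_double_Suc)

text \<open>Each aligned pair \<open>t (2 * j)\<close>, \<open>t (2 * j + 1)\<close> consists of different values, and an odd shift
  makes every unaligned pair in the window a copy of an aligned one.\<close>

lemma tm_no_odd_overlap:
  assumes "odd l"
  shows "\<exists>k\<le>l. tm (i + k) \<noteq> tm (i + l + k)"
proof (rule ccontr)
  assume "\<not> ?thesis"
  then have eq: "tm (i + l + k) = tm (i + k)" if "k \<le> l" for k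
    using that by auto
  have step: "tm (i + Suc k) \<noteq> tm (i + k)" if "k < l" for k
  proof (cases "even (i + k)")
    case True
    then show ?thesis using tm_Suc_even[of "i + k"] by simp
  next
    case False
    then have "even (i + l + k)" using assms by auto
    then show ?thesis
      using tm_Suc_even[of "i + l + k"] eq[of k] eq[of "Suc k"] that by simp
  qed
  have "tm (i + k) = (tm i \<noteq> odd k)" if "k \<le> l" for k
    using that
  proof (induction k)
    case (Suc k)
    then show ?case using step[of k] by auto
  qed simp
  from this[of l] eq[of 0] assms show False by simp
qed

lemma tm_overlap_free:
  assumes "l > 0"
  shows "\<exists>k\<le>l. tm (i + k) \<noteq> tm (i + l + k)"
  using assms
proof (induction l arbitrary: i rule: less_induct)
  case (less l)
  show ?case
  proof (cases "odd l")
    case True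
    then show ?thesis by (rule tm_no_odd_overlap)
  next
    case False
    then obtain m where l: "l = 2 * m" by (auto elim: evenE)
    have "i = 2 * (i div 2) \<or> i = Suc (2 * (i div 2))" by presburger
    then obtain j where j: "i = 2 * j \<or> i = Suc (2 * j)" by blast
    obtain k where k: "k \<le> m" "tm (j + k) \<noteq> tm (j + m + k)"
      using less.IH[of m j] less.prems l by auto
    from j have "tm (i + 2 * k) \<noteq> tm (i + l + 2 * k)"
    proof
      assume i: "i = 2 * j"
      have "i + 2 * k = 2 * (j + k)" "i + l + 2 * k = 2 * (j + m + k)"
        by (simp_all add: i l)
      then show ?thesis using k by (simp only: tm_double) simp
    next
      assume i: "i = Suc (2 * j)"
      have "i + 2 * k = Suc (2 * (j + k))" "i + l + 2 * k = Suc (2 * (j + m + k))"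
        by (simp_all add: i l)
      then show ?thesis using k by (simp only: tm_double_Suc) simp
    qed
    moreover have "2 * k \<le> l" using k l by simp
    ultimately show ?thesis by blast
  qed
qed

section \<open>The fixed point as the word of Thue-Morse increments\<close>

definition tm_increment :: "letter word" where
  "tm_increment n = (if tm n = tm (Suc n) then L1 else if tm n then L2 else L0)"

text \<open>Both sides depend only on \<open>t n\<close> and \<open>t (n + 1)\<close>: these determine \<open>t\<close> at the four positions from
  \<open>2 * n\<close> to \<open>2 * n + 3\<close>, and the increments on the right stay within them. The block bounds count
  2 symbols per letter plus the telescoping sum of the increments.\<close>

lemma vtm_morph_tm_increment:
  "vtm_morph (tm_increment n)
    = subsequence tm_increment (2 * n + of_bool (tm n)) (2 * Suc n + of_bool (tm (Suc n)))"
proof -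
  have tm: "tm (2 * n) = tm n" "tm (Suc (2 * n)) = (\<not> tm n)"
    "tm (Suc (Suc (2 * n))) = tm (Suc n)" "tm (Suc (Suc (Suc (2 * n)))) = (\<not> tm (Suc n))"
    using tm_double[of n] tm_double_Suc[of n] tm_double[of "Suc n"] tm_double_Suc[of "Suc n"]
    by simp_all
  show ?thesis
    by (cases "tm n"; cases "tm (Suc n)")
      (simp_all add: subsequence_def tm_increment_def tm upt_rec)
qed

lemma concat_vtm_morph_prefix_tm_increment:
  "concat (map vtm_morph (prefix n tm_increment)) = prefix (2 * n + of_bool (tm n)) tm_increment"
proof (induction n)
  case 0
  show ?case by (simp add: tm_0)
next
  case (Suc n)
  let ?p = "\<lambda>n. 2 * n + of_bool (tm n) :: nat"
  have le: "?p n \<le> ?p (Suc n)" by (cases "tm n") auto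
  have "concat (map vtm_morph (prefix (Suc n) tm_increment))
      = prefix (?p n) tm_increment @ subsequence tm_increment (?p n) (?p (Suc n))"
    using Suc by (simp add: vtm_morph_tm_increment)
  also have "\<dots> = prefix (?p (Suc n)) tm_increment"
    using subsequence_append[of tm_increment "?p n" "?p (Suc n) - ?p n"] le by simp
  finally show ?case .
qed

lemma vtm_eq_tm_increments: "vtm = tm_increment"
proof -
  have "morph_word vtm_morph tm_increment = tm_increment"
    unfolding morph_word_def concat_vtm_morph_prefix_tm_increment
    by (rule ext) (subst subsequence_nth, simp_all)
  then show ?thesis
    unfolding vtm_def by (rule the1_equality[OF vtm_ex1])
qed

section \<open>Squares and reflection squares\<close>

lemma vtm_not_periodic:
  assumes "l > 0"
  shows "\<exists>k<l. vtm (i + k) \<noteq> vtm (i + l + k)"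
proof (rule ccontr)
  assume "\<not> ?thesis"
  then have eq: "vtm (i + k) = vtm (i + l + k)" if "k < l" for k
    using that by auto
  define t where "t n = (of_bool (tm n) :: int)" for n
  have t01: "t n = 0 \<or> t n = 1" for n
    by (simp add: t_def)
  have incr: "t (Suc n) - t n = (case vtm n of L0 \<Rightarrow> 1 | L1 \<Rightarrow> 0 | L2 \<Rightarrow> -1)" for n
    by (simp add: vtm_eq_tm_increments tm_increment_def t_def)
  have tele: "t (i + k) - t i = t (i + l + k) - t (i + l)" if "k \<le> l" for k
    using that
  proof (induction k)
    case (Suc k)
    then show ?case using incr[of "i + k"] incr[of "i + l + k"] eq[of k] by simp
  qed simp
  \<comment> \<open>A nonzero common increment would drive three values in \<open>{0, 1}\<close> apart by 2.\<close>
  have "t (i + l) = t i"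
    using tele[of l] t01[of i] t01[of "i + l"] t01[of "i + l + l"] by auto
  then have "tm (i + k) = tm (i + l + k)" if "k \<le> l" for k
    using tele[OF that] by (auto simp: t_def of_bool_def split: if_splits)
  then show False using tm_overlap_free[OF assms, of i] by blast
qed

lemma factor_nth:
  assumes "factor u w"
  shows "\<exists>i. \<forall>k<length u. u ! k = w (i + k)"
  using assms unfolding factor_def by auto

lemma vtm_no_square_factor:
  assumes "x \<noteq> []"
  shows "\<not> factor (x @ x) vtm"
proof
  assume "factor (x @ x) vtm"
  then obtain i where i: "\<And>k. k < length (x @ x) \<Longrightarrow> (x @ x) ! k = vtm (i + k)"
    using factor_nth by blast
  have "vtm (i + k) = vtm (i + length x + k)" if "k < length x" for k
    using i[of k] i[of "length x + k"] that by (simp add: nth_append add.assoc)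
  then show False using vtm_not_periodic[of "length x" i] assms by auto
qed

lemma vtm_no_reflection_factor:
  assumes "x \<noteq> []"
  shows "\<not> factor (x @ rev x) vtm"
proof
  assume "factor (x @ rev x) vtm"
  then obtain i where i: "\<And>k. k < length (x @ rev x) \<Longrightarrow> (x @ rev x) ! k = vtm (i + k)"
    using factor_nth by blast
  obtain m where m: "length x = Suc m" using assms by (cases x) auto
  have "vtm (i + m) = vtm (i + m + 1)"
    using i[of m] i[of "Suc m"] m by (simp add: nth_append rev_nth)
  then show False using vtm_not_periodic[of 1 "i + m"] by simp
qed

theorem theorem4p3:
  shows "(\<forall>l>0. avoids vtm (rev_squares l)) \<and>
         avoids vtm reflection_squares \<and> avoids vtm squares"
proof (intro conjI allI impI)
  fix l :: nat
  assume l: "l > 0"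
  show "avoids vtm (rev_squares l)"
    unfolding avoids_def
  proof
    assume "\<exists>u\<in>rev_squares l. factor u vtm"
    then obtain x h where x: "length x = l" and f: "factor (x @ rev_action l h x) vtm"
      by (auto simp: rev_squares_def)
    have "rev_action l h x = x \<or> rev_action l h x = rev x"
      using x by (simp add: rev_action_def)
    moreover have "x \<noteq> []" using x l by auto
    ultimately show False
      using f vtm_no_square_factor[of x] vtm_no_reflection_factor[of x] by auto
  qed
next
  show "avoids vtm reflection_squares"
    unfolding avoids_def
  proof
    assume "\<exists>u\<in>reflection_squares. factor u vtm"
    then obtain y where y: "y \<noteq> []" and f: "factor (rev y @ y) vtm"
      by (auto simp: reflection_squares_def rev_action_def)
    then show False using vtm_no_reflection_factor[of "rev y"] by simp
  qed
next
  show "avoids vtm squares"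
    using vtm_no_square_factor by (auto simp: avoids_def squares_def)
qed

end
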